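(* Let $\mu^y$ be the posterior measure associated with the uniform prior $\mu_0=\mu_\gamma$ and the function $\Phi$. Suppose that $\Phi:X\to\mathbb{R}$ is Lipschitz continuous on bounded sets, i.e., for every $r>0$ there exists $L=L_r>0$ such that $|\Phi(x_1)-\Phi(x_2)|\le L\|x_1-x_2\|_X$ for all $x_1,x_2\in X$ with $\|x_1\|_X,\|x_2\|_X\le r$. For each $\delta>0$ let $x^\delta\in E_\gamma^\delta$ be a (not necessarily unique) maximizer of $J^\delta(x):=\mu^y(B^\delta(x))$ over $E_\gamma^\delta$. Then the following hold: (i) For every $\{\delta_n\}_{n\in\mathbb{N}} \subset (0,\infty)$, the sequence $\{x^{\delta_n}\}_{n\in\mathbb{N}}$ contains a subsequence that converges strongly in $X$ to some $\bar{x} \in E_\gamma$. (ii) For every $\{\delta_n\}_{n\in\mathbb{N}} \subset (0,\infty)$ with $\delta_n\to0$, any cluster point $\bar{x}\in E_\gamma$ of $\{x^{\delta_n}\}_{n\in\mathbb{N}}$ is a minimizer of $I$. (iii) A point $\hat{x} \in X$ is a minimizer of $I$ if and only if it is a generalized MAP estimate for $\mu^y$.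
   Context: $X := \{x=\{x_k\}_{k\in\mathbb{N}} \in \ell^\infty: \lim_{k\to\infty} x_k = 0\}$ (i.e. $X=c_0$), endowed with the norm $\|x\|_X=\|x\|_\infty=\sup_k|x_k|$; $e_k$ denotes the $k$-th standard unit vector and $B^\delta(x)$ the open ball of radius $\delta$ around $x$. Let $\{\gamma_k\}_{k\in\mathbb{N}}$ be non-negative reals with $\gamma_k\to0$. The prior $\mu_0=\mu_\gamma$ is the law on $X$ of $\xi := \sum_{k=1}^\infty \gamma_k \xi_k e_k$, where the $\xi_k \sim \mathcal{U}[-1,1]$ are independent and uniformly distributed on $[-1,1]$ (the series converges almost surely in $X$). $E_\gamma := \{x \in X : |x_k| \le \gamma_k \text{ for all } k \in \mathbb{N}\}$ and, for $\delta>0$, $E_\gamma^\delta := \{x \in X: |x_k| \le \max \{\gamma_k - \delta, 0\} \text{ for all } k \in \mathbb{N}\}$. For fixed data $y$ in a Banach space $Y$ and $\Phi:X\to\mathbb{R}$ (short for $\Phi(\cdot;y)$), the posterior is the probability measure $$\mu^y(A) = \frac{1}{Z(y)} \int_{A} \exp(-\Phi(x))\,\mu_0(\mathrm{d}x),\quad A\in\mathcal{B}(X),\qquad Z(y) := \int_X \exp(-\Phi(x))\,\mu_0(\mathrm{d}x),$$ where $Z(y)$ is assumed positive and finite. The functional $I:X\to\mathbb{R}\cup\{\infty\}$ is defined by $I(x):=\Phi(x)$ if $x\in E_\gamma$ and $I(x):=\infty$ otherwise. A generalized MAP estimate for $\mu^y$ is a generalized mode of $\mu^y$, i.e. a point $\hat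 x\in X$ such that for every sequence $\{\delta_n\}_{n\in\mathbb{N}}\subset(0,\infty)$ with $\delta_n\to 0$ there exists a sequence $\{w_n\}_{n\in\mathbb{N}}\subset X$ with $w_n\to\hat x$ in $X$ and $\lim_{n\to\infty}\mu^y(B^{\delta_n}(w_n))/M^{\delta_n}=1$, where $M^\delta := \sup_{x\in X}\mu^y(B^\delta(x))$. *)

theory Defs
  imports "HOL-Probability.Probability"
begin

text \<open>
  The separable Banach space of real null sequences with the supremum norm. Null sequences are
  automatically bounded, so membership in the space of bounded sequences need not be demanded
  separately. Sequences are indexed from 0.
\<close>

typedef c0 = "{x :: nat \<Rightarrow> real. x \<longlonglongrightarrow> 0}"
  morphisms coord Abs_c0
  by (rule exI[of _ "\<lambda>_. 0"]) simp

setup_lifting type_definition_c0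

lemma coord_tendsto_0: "coord x \<longlonglongrightarrow> 0"
  using coord[of x] by simp

lemma c0_eqI: "(\<And>k. coord x k = coord y k) \<Longrightarrow> x = y"
  by (simp add: coord_inject[symmetric] fun_eq_iff)

lemma bdd_above_abs_coord: "bdd_above (range (\<lambda>k. \<bar>coord x k\<bar>))"
proof -
  have "Bseq (coord x)"
    using coord_tendsto_0 convergent_def convergent_imp_Bseq by blast
  then obtain K where "\<And>n. norm (coord x n) \<le> K"
    by (auto simp: Bseq_def)
  then show ?thesis
    by (intro bdd_aboveI[of _ K]) auto
qed

instantiation c0 :: real_normed_vector
begin

lift_definition zero_c0 :: c0 is "\<lambda>_. 0" by simp
lift_definition plus_c0 :: "c0 \<Rightarrow> c0 \<Rightarrow> c0" is "\<lambda>x y k. x k + y k"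
  by (metis tendsto_add_zero)
lift_definition uminus_c0 :: "c0 \<Rightarrow> c0" is "\<lambda>x k. - x k"
  by (metis minus_zero tendsto_minus)
lift_definition minus_c0 :: "c0 \<Rightarrow> c0 \<Rightarrow> c0" is "\<lambda>x y k. x k - y k"
  by (metis diff_zero tendsto_diff)
lift_definition scaleR_c0 :: "real \<Rightarrow> c0 \<Rightarrow> c0" is "\<lambda>a x k. a * x k"
  by (metis tendsto_mult_right_zero)
definition norm_c0 :: "c0 \<Rightarrow> real" where
  "norm_c0 x = (SUP k. \<bar>coord x k\<bar>)"
definition sgn_c0 :: "c0 \<Rightarrow> c0" where
  "sgn x = scaleR (inverse (norm x)) (x :: c0)"
definition dist_c0 :: "c0 \<Rightarrow> c0 \<Rightarrow> real" where
  "dist_c0 x y = norm (x - y)"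
definition uniformity_c0 :: "(c0 \<times> c0) filter" where
  "uniformity_c0 = (INF e\<in>{0 <..}. principal {(x, y). dist x y < e})"
definition open_c0 :: "c0 set \<Rightarrow> bool" where
  "open_c0 S = (\<forall>x\<in>S. \<forall>\<^sub>F (x', y) in uniformity. x' = x \<longrightarrow> y \<in> S)"

instance
proof
  fix x y z :: c0 and a b :: real and S :: "c0 set"
  have le: "\<bar>coord u k\<bar> \<le> norm u" for u :: c0 and k
    unfolding norm_c0_def by (rule cSUP_upper[OF _ bdd_above_abs_coord]) simp
  show "x + y + z = x + (y + z)" by transfer (simp add: add.assoc)
  show "x + y = y + x" by transfer (simp add: add.commute)
  show "0 + x = x" by transfer simp
  show "- x + x = 0" by transfer simp
  show "x - y = x + - y" by transfer simp
  show "a *\<^sub>R (x + y) = a *\<^sub>R x + a *\<^sub>R y" by transfer (simp add: distrib_left)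
  show "(a + b) *\<^sub>R x = a *\<^sub>R x + b *\<^sub>R x" by transfer (simp add: distrib_right)
  show "a *\<^sub>R b *\<^sub>R x = (a * b) *\<^sub>R x" by transfer (simp add: mult.assoc)
  show "1 *\<^sub>R x = x" by transfer simp
  show "sgn x = scaleR (inverse (norm x)) (x :: c0)" by (rule sgn_c0_def)
  show "dist x y = norm (x - y)" by (rule dist_c0_def)
  show "(uniformity :: (c0 \<times> c0) filter) = (INF e\<in>{0 <..}. principal {(x, y). dist x y < e})"
    by (rule uniformity_c0_def)
  show "open S = (\<forall>x\<in>S. \<forall>\<^sub>F (x', y) in uniformity. x' = x \<longrightarrow> y \<in> S)"
    by (rule open_c0_def)
  show "(norm x = 0) = (x = 0)"
  proof
    assume "norm x = 0"
    then have "coord x k = 0" for k using le[of x k] by simp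
    then show "x = 0" by (intro c0_eqI) (simp add: zero_c0.rep_eq)
  qed (simp add: norm_c0_def zero_c0.rep_eq)
  show "norm (x + y) \<le> norm x + norm y"
    unfolding norm_c0_def[of "x + y"]
  proof (rule cSUP_least)
    fix k
    show "\<bar>coord (x + y) k\<bar> \<le> norm x + norm y"
      using le[of x k] le[of y k] by (simp add: plus_c0.rep_eq)
  qed simp
  have scale_le: "norm (c *\<^sub>R u) \<le> \<bar>c\<bar> * norm u" for c and u :: c0
    unfolding norm_c0_def[of "c *\<^sub>R u"]
    by (rule cSUP_least) (auto simp: scaleR_c0.rep_eq abs_mult intro!: mult_left_mono le)
  show "norm (a *\<^sub>R x) = \<bar>a\<bar> * norm x"
  proof (cases "a = 0")
    case True
    have "0 *\<^sub>R x = 0" by transfer simp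
    then show ?thesis using True by (simp add: norm_c0_def zero_c0.rep_eq)
  next
    case False
    have "inverse a *\<^sub>R a *\<^sub>R x = x"
      using False by transfer (simp add: mult.assoc[symmetric])
    then have "norm x \<le> \<bar>inverse a\<bar> * norm (a *\<^sub>R x)"
      using scale_le[of "inverse a" "a *\<^sub>R x"] by simp
    then have "\<bar>a\<bar> * norm x \<le> norm (a *\<^sub>R x)"
      using False by (simp add: field_simps)
    then show ?thesis using scale_le[of a x] by simp
  qed
qed

end

lemma abs_coord_le_norm: "\<bar>coord x k\<bar> \<le> norm x"
  unfolding norm_c0_def by (rule cSUP_upper[OF _ bdd_above_abs_coord]) simp

lemma norm_c0_leI: "(\<And>k. \<bar>coord x k\<bar> \<le> B) \<Longrightarrow> norm x \<le> B"
  unfolding norm_c0_def by (rule cSUP_least) auto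

instance c0 :: banach
proof
  fix X :: "nat \<Rightarrow> c0"
  assume "Cauchy X"
  have "uniformly_Cauchy_on UNIV (\<lambda>n. coord (X n))"
    unfolding uniformly_Cauchy_on_def
  proof (intro allI impI)
    fix e :: real assume "e > 0"
    with \<open>Cauchy X\<close> obtain M where "\<And>m n. m \<ge> M \<Longrightarrow> n \<ge> M \<Longrightarrow> dist (X m) (X n) < e"
      unfolding Cauchy_def by blast
    moreover have "dist (coord (X m) k) (coord (X n) k) \<le> dist (X m) (X n)" for m n k
      using abs_coord_le_norm[of "X m - X n" k] by (simp add: dist_norm minus_c0.rep_eq)
    ultimately show "\<exists>M. \<forall>k\<in>UNIV. \<forall>m\<ge>M. \<forall>n\<ge>M. dist (coord (X m) k) (coord (X n) k) < e"
      by (meson le_less_trans)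
  qed
  then obtain l where l: "uniform_limit UNIV (\<lambda>n. coord (X n)) l sequentially"
    using Cauchy_uniformly_convergent unfolding uniformly_convergent_on_def by blast
  have l0: "l \<longlonglongrightarrow> 0"
  proof (rule swap_uniform_limit')
    show "\<forall>\<^sub>F n in sequentially. (coord (X n) \<longlongrightarrow> 0) sequentially"
      by (simp add: coord_tendsto_0)
    show "uniform_limit UNIV (\<lambda>n. coord (X n)) l sequentially" by (rule l)
  qed auto
  have "X \<longlonglongrightarrow> Abs_c0 l"
    unfolding lim_sequentially
  proof (intro allI impI)
    fix e :: real assume "e > 0"
    then have "\<forall>\<^sub>F n in sequentially. \<forall>k\<in>UNIV. dist (coord (X n) k) (l k) < e / 2"
      using l by (intro uniform_limitD) auto
    then obtain N where N: "\<And>n k. n \<ge> N \<Longrightarrow> dist (coord (X n) k) (l k) < e / 2"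
      unfolding eventually_sequentially by blast
    have "dist (X n) (Abs_c0 l) < e" if "n \<ge> N" for n
    proof -
      have "norm (X n - Abs_c0 l) \<le> e / 2"
        using N[OF that] l0
        by (intro norm_c0_leI) (auto simp: minus_c0.rep_eq Abs_c0_inverse dist_real_def less_imp_le)
      then show ?thesis using \<open>e > 0\<close> by (simp add: dist_norm)
    qed
    then show "\<exists>N. \<forall>n\<ge>N. dist (X n) (Abs_c0 l) < e" by blast
  qed
  then show "convergent X" by (auto simp: convergent_def)
qed

instance c0 :: second_countable_topology
proof
  define f :: "rat list \<Rightarrow> c0" where
    "f qs = Abs_c0 (\<lambda>k. if k < length qs then of_rat (qs ! k) else 0)" for qs
  have f: "coord (f qs) k = (if k < length qs then of_rat (qs ! k) else 0)" for qs k
  proof -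
    have "(\<lambda>k. if k < length qs then of_rat (qs ! k) else (0::real)) \<longlonglongrightarrow> 0"
      by (rule tendsto_eventually) (auto simp: eventually_sequentially intro!: exI[of _ "length qs"])
    then show ?thesis unfolding f_def by (simp add: Abs_c0_inverse)
  qed
  have dense: "\<exists>qs. dist x (f qs) < e" if "e > 0" for x e
  proof -
    have "\<exists>N. \<forall>k\<ge>N. \<bar>coord x k\<bar> < e / 2"
      using coord_tendsto_0[of x] half_gt_zero[OF \<open>e > 0\<close>]
      unfolding lim_sequentially dist_real_def diff_0_right by blast
    then obtain N where N: "\<And>k. k \<ge> N \<Longrightarrow> \<bar>coord x k\<bar> < e / 2" by blast
    have "\<exists>q::rat. \<bar>coord x k - of_rat q\<bar> < e / 2" for k
    proof -
      obtain q :: rat where "coord x k - e / 2 < of_rat q" "of_rat q < coord x k + e / 2"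
        using of_rat_dense[of "coord x k - e / 2" "coord x k + e / 2"] \<open>e > 0\<close> by auto
      then show ?thesis by (intro exI[of _ q]) (simp only: abs_less_iff, linarith)
    qed
    then obtain q :: "nat \<Rightarrow> rat" where q: "\<And>k. \<bar>coord x k - of_rat (q k)\<bar> < e / 2" by metis
    have "norm (x - f (map q [0..<N])) \<le> e / 2"
      using N q by (intro norm_c0_leI) (auto simp: minus_c0.rep_eq f less_imp_le)
    then show ?thesis using \<open>e > 0\<close> by (intro exI[of _ "map q [0..<N]"]) (simp add: dist_norm)
  qed
  define B where "B = (\<lambda>(qs, n). ball (f qs) (1 / real (Suc n))) ` (UNIV :: (rat list \<times> nat) set)"
  have "topological_basis B"
  proof (rule topological_basisI)
    show "open U" if "U \<in> B" for U using that by (auto simp: B_def)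
    fix U :: "c0 set" and x assume "open U" "x \<in> U"
    then obtain e where e: "e > 0" "ball x e \<subseteq> U" by (auto simp: open_contains_ball)
    obtain n where n: "1 / real (Suc n) < e / 2"
      using e nat_approx_posE[of "e / 2"] by auto
    obtain qs where qs: "dist x (f qs) < 1 / real (Suc n)" using dense[of "1 / real (Suc n)" x] by auto
    have "ball (f qs) (1 / real (Suc n)) \<subseteq> ball x e"
    proof
      fix z assume "z \<in> ball (f qs) (1 / real (Suc n))"
      then have "dist (f qs) z < 1 / real (Suc n)" by simp
      then show "z \<in> ball x e" using qs n dist_triangle[of x z "f qs"] by simp
    qed
    moreover have "x \<in> ball (f qs) (1 / real (Suc n))" using qs by (simp add: dist_commute)
    moreover have "ball (f qs) (1 / real (Suc n)) \<in> B" unfolding B_def by auto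
    ultimately show "\<exists>B'\<in>B. x \<in> B' \<and> B' \<subseteq> U" using e by blast
  qed
  moreover have "countable B" unfolding B_def by simp
  ultimately show "\<exists>B::c0 set set. countable B \<and> open = generate_topology B"
    using topological_basis_imp_subbasis by blast
qed

lift_definition unit_vec :: "nat \<Rightarrow> c0" is "\<lambda>k j. if j = k then 1 else 0"
  by (rule tendsto_eventually) (metis (mono_tags, lifting) eventually_sequentiallyI not_less_eq_eq order_refl)

definition box_set :: "(nat \<Rightarrow> real) \<Rightarrow> c0 set" where
  "box_set \<gamma> = {x. \<forall>k. \<bar>coord x k\<bar> \<le> \<gamma> k}"

definition inner_box_set :: "(nat \<Rightarrow> real) \<Rightarrow> real \<Rightarrow> c0 set" where
  "inner_box_set \<gamma> \<delta> = {x. \<forall>k. \<bar>coord x k\<bar> \<le> max (\<gamma> k - \<delta>) 0}"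

definition uniform_iid :: "'w measure \<Rightarrow> (nat \<Rightarrow> 'w \<Rightarrow> real) \<Rightarrow> bool" where
  "uniform_iid P \<xi> \<longleftrightarrow> prob_space P \<and> prob_space.indep_vars P (\<lambda>_. borel) \<xi> UNIV \<and>
     (\<forall>k. distr P borel (\<xi> k) = uniform_measure lborel {-1..1})"

text \<open>
  The law of the random series. Where the series diverges, \<^const>\<open>suminf\<close> is an unspecified constant;
  for weights tending to 0 and iid uniform coefficients this is a null event.
\<close>

definition uniform_prior :: "'w measure \<Rightarrow> (nat \<Rightarrow> 'w \<Rightarrow> real) \<Rightarrow> (nat \<Rightarrow> real) \<Rightarrow> c0 measure" where
  "uniform_prior P \<xi> \<gamma> = distr P borel (\<lambda>\<omega>. \<Sum>k. (\<gamma> k * \<xi> k \<omega>) *\<^sub>R unit_vec k)"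

lemma measurable_uniform_series:
  assumes "uniform_iid P \<xi>"
  shows "(\<lambda>\<omega>. \<Sum>k. (\<gamma> k * \<xi> k \<omega>) *\<^sub>R unit_vec k) \<in> borel_measurable P"
proof -
  have [measurable]: "\<xi> k \<in> borel_measurable P" for k
    using assms by (auto simp: uniform_iid_def prob_space.indep_vars_def)
  show ?thesis by measurable
qed

definition normalization_const :: "'a measure \<Rightarrow> ('a \<Rightarrow> real) \<Rightarrow> ennreal" where
  "normalization_const \<mu>0 \<Phi> = (\<integral>\<^sup>+ x. ennreal (exp (- \<Phi> x)) \<partial>\<mu>0)"

definition posterior :: "'a measure \<Rightarrow> ('a \<Rightarrow> real) \<Rightarrow> 'a measure" where
  "posterior \<mu>0 \<Phi> =
     scale_measure (1 / normalization_const \<mu>0 \<Phi>) (density \<mu>0 (\<lambda>x. ennreal (exp (- \<Phi> x))))"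

definition functional_I :: "(c0 \<Rightarrow> real) \<Rightarrow> (nat \<Rightarrow> real) \<Rightarrow> c0 \<Rightarrow> ereal" where
  "functional_I \<Phi> \<gamma> x = (if x \<in> box_set \<gamma> then ereal (\<Phi> x) else \<infinity>)"

text \<open>The supremum below is meaningful for finite measures, for which the ball masses are bounded.\<close>

definition sup_ball_mass :: "'a::metric_space measure \<Rightarrow> real \<Rightarrow> real" where
  "sup_ball_mass \<mu> \<delta> = (SUP x. measure \<mu> (ball x \<delta>))"

definition generalized_mode :: "'a::metric_space measure \<Rightarrow> 'a \<Rightarrow> bool" where
  "generalized_mode \<mu> x \<longleftrightarrow>
     (\<forall>\<delta> :: nat \<Rightarrow> real. (\<forall>n. \<delta> n > 0) \<and> \<delta> \<longlonglongrightarrow> 0 \<longrightarrow>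
        (\<exists>w. w \<longlonglongrightarrow> x \<and>
             (\<lambda>n. measure \<mu> (ball (w n) (\<delta> n)) / sup_ball_mass \<mu> (\<delta> n)) \<longlonglongrightarrow> 1))"

definition lipschitz_on_bounded_sets :: "('a::real_normed_vector \<Rightarrow> real) \<Rightarrow> bool" where
  "lipschitz_on_bounded_sets \<Phi> \<longleftrightarrow>
     (\<forall>r>0. \<exists>L>0. \<forall>x1 x2. norm x1 \<le> r \<and> norm x2 \<le> r \<longrightarrow>
        \<bar>\<Phi> x1 - \<Phi> x2\<bar> \<le> L * norm (x1 - x2))"

end

theory Submission
  imports Defs
begin

text \<open>
  The uniform prior is flat at the scale of small balls. An open ball of radius \<open>\<delta>\<close> in \<open>c0\<close> is an
  open box, so by independence its prior mass is a product of interval masses. The factor of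
  coordinate \<open>k\<close> is at most \<open>\<delta> / \<gamma> k\<close> if \<open>\<delta> \<le> \<gamma> k\<close> and at most 1 otherwise, with equality in every coordinate as soon as the
  centre lies in the inner box. Hence all balls centred in the inner box share one and the same
  positive mass \<open>c(\<delta>)\<close>, and no other ball has a larger one
  (\<open>prior_ball_eq\<close>, \<open>prior_ball_le\<close>).

  Consequently, only the density \<open>exp (- \<Phi>) / Z\<close> decides which ball has the largest posterior
  mass. By the Lipschitz condition, \<open>\<Phi>\<close> varies by at most \<open>L * \<delta>\<close> within distance \<open>\<delta>\<close> of its
  centre, so a ball around \<open>w\<close> has posterior mass at most \<open>exp (L * \<delta> - \<Phi> w) * c(\<delta>) / Z\<close>, and at
  most \<open>exp (- m) * c(\<delta>) / Z\<close> with \<open>m\<close> the minimum of \<open>\<Phi>\<close> on the box. Conversely, every point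
  \<open>x\<close> of the box can be moved into the inner box at a cost of \<open>\<delta>\<close>, and the ball around the moved
  point has mass at least \<open>exp (- \<Phi> x - 2 * L * \<delta>) * c(\<delta>) / Z\<close>. In quotients of ball masses the
  unknown \<open>c(\<delta>)\<close> and \<open>Z\<close> cancel, and everything is determined by \<open>\<Phi>\<close> up to an error of order
  \<open>\<delta>\<close>:
  maximizers \<open>w\<close> over the inner box satisfy \<open>\<Phi> w \<le> m + 3 * L * \<delta>\<close>, which makes their cluster
  points minimizers; and the mass of the ball around \<open>w\<close> relative to the largest one is at most
  \<open>exp (m - \<Phi> w + 3 * L * \<delta>)\<close>, and at least \<open>exp (- 2 * L * \<delta>)\<close> if \<open>w\<close> is a moved minimizer,
  which identifies generalized modes with minimizers.

  The existence of convergent subsequences and of minimizers comes from the compactness of the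
  box: its side lengths tend to zero, so that on the box norm convergence is the same as
  coordinatewise convergence.
\<close>

section \<open>Balls and boxes in the space of null sequences\<close>

lemma coord_simps [simp]:
  "coord 0 k = 0" "coord (x + y) k = coord x k + coord y k" "coord (x - y) k = coord x k - coord y k"
  "coord (a *\<^sub>R x) k = a * coord x k" "coord (unit_vec j) k = (if k = j then 1 else 0)"
  by (simp_all add: zero_c0.rep_eq plus_c0.rep_eq minus_c0.rep_eq scaleR_c0.rep_eq unit_vec.rep_eq)

lemma coord_sum [simp]: "coord (sum f A) k = (\<Sum>a\<in>A. coord (f a) k)"
  by (induction A rule: infinite_finite_induct) auto

text \<open>
  A null sequence attains the supremum of its absolute values unless it is zero, so the strict
  inequality may be checked coordinate by coordinate; in particular open balls are open boxes.
\<close>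
lemma norm_less_iff_coord:
  assumes "d > 0" shows "norm x < d \<longleftrightarrow> (\<forall>k. \<bar>coord x k\<bar> < d)"
proof
  assume "norm x < d" then show "\<forall>k. \<bar>coord x k\<bar> < d"
    using abs_coord_le_norm le_less_trans by blast
next
  assume *: "\<forall>k. \<bar>coord x k\<bar> < d"
  obtain N where N: "\<And>k. k \<ge> N \<Longrightarrow> \<bar>coord x k\<bar> < d / 2"
    using coord_tendsto_0[of x] half_gt_zero[OF assms] 
    unfolding lim_sequentially dist_real_def diff_0_right by blast
  define M where "M = Max (insert (d / 2) ((\<lambda>k. \<bar>coord x k\<bar>) ` {..<N}))"
  have "M < d" using * assms unfolding M_def by (subst Max_less_iff) auto
  moreover have "norm x \<le> M"
  proof (rule norm_c0_leI)
    fix k show "\<bar>coord x k\<bar> \<le> M"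
    proof (cases "k < N")
      case True then show ?thesis unfolding M_def by (intro Max_ge) auto
    next
      case False
      have "d / 2 \<le> M" unfolding M_def by (intro Max_ge) auto
      then show ?thesis using N[of k] False by simp
    qed
  qed
  ultimately show "norm x < d" by simp
qed

lemma mem_ball_iff_coord:
  "d > 0 \<Longrightarrow> z \<in> ball x d \<longleftrightarrow> (\<forall>k. \<bar>coord z k - coord x k\<bar> < d)"
  using norm_less_iff_coord[of d "z - x"] by (simp add: dist_norm norm_minus_commute)

text \<open>\<^const>\<open>Abs_c0\<close> is specified only on null sequences; this is how each point built below is
  shown to have the intended coordinates.\<close>
lemma coord_Abs_c0_dominated:
  assumes "g \<longlonglongrightarrow> 0" "\<And>k. \<bar>f k\<bar> \<le> g k"
  shows "coord (Abs_c0 f) = f"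
proof -
  have "f \<longlonglongrightarrow> 0"
    using assms by (intro Lim_null_comparison[of f g]) auto
  then show ?thesis by (simp add: Abs_c0_inverse)
qed

text \<open>
  The coordinates beyond some index are uniformly small on a box whose sides tend to zero, so only
  finitely many coordinates matter for convergence.
\<close>
lemma box_set_tendstoI:
  fixes f :: "nat \<Rightarrow> c0"
  assumes lim: "\<gamma> \<longlonglongrightarrow> 0" and f: "\<And>n. f n \<in> box_set \<gamma>" and x: "x \<in> box_set \<gamma>"
    and pt: "\<And>k. (\<lambda>n. coord (f n) k) \<longlonglongrightarrow> coord x k"
  shows "f \<longlonglongrightarrow> x"
proof (rule tendstoI)
  fix e :: real assume "e > 0"
  then obtain N where N: "\<And>k. k \<ge> N \<Longrightarrow> \<gamma> k < e / 2"
    using order_tendstoD(2)[OF lim, of "e / 2"] by (auto simp: eventually_sequentially)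
  have "\<forall>\<^sub>F n in sequentially. \<forall>k\<in>{..<N}. \<bar>coord (f n) k - coord x k\<bar> < e"
    using pt \<open>e > 0\<close> by (intro eventually_ball_finite) (auto simp: tendsto_iff dist_real_def)
  then show "\<forall>\<^sub>F n in sequentially. dist (f n) x < e"
  proof eventually_elim
    case (elim n)
    have "\<bar>coord (f n) k - coord x k\<bar> < e" for k
    proof (cases "k < N")
      case False
      have "\<bar>coord (f n) k\<bar> \<le> \<gamma> k" "\<bar>coord x k\<bar> \<le> \<gamma> k"
        using f x by (auto simp: box_set_def)
      then show ?thesis using N[of k] False by simp
    qed (use elim in auto)
    then show ?case using norm_less_iff_coord[OF \<open>e > 0\<close>, of "f n - x"] by (simp add: dist_norm)
  qed
qed

text \<open>
  The sequence of coordinates lives in a product of compact intervals, which is compact by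
  Tychonoff and metrizable; the pointwise limit of a subsequence is a limit in norm.
\<close>
lemma compact_box_set:
  assumes lim: "\<gamma> \<longlonglongrightarrow> 0" shows "compact (box_set \<gamma>)"
proof -
  let ?K = "PiE UNIV (\<lambda>k. {- \<gamma> k .. \<gamma> k})"
  have "compactin (product_topology (\<lambda>k. euclidean) UNIV) ?K"
    by (subst compactin_PiE) auto
  then have "seq_compact ?K"
    by (simp add: euclidean_product_topology compact_eq_seq_compact_metric)
  show ?thesis
    unfolding compact_eq_seq_compact_metric seq_compact_def
  proof (intro allI impI)
    fix f :: "nat \<Rightarrow> c0" assume f: "\<forall>n. f n \<in> box_set \<gamma>"
    then have "\<forall>n. coord (f n) \<in> ?K" by (auto simp: box_set_def abs_le_iff minus_le_iff)
    then obtain l r where l: "l \<in> ?K" and r: "strict_mono r" and "((\<lambda>n. coord (f n)) \<circ> r) \<longlonglongrightarrow> l"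
      using seq_compactE[OF \<open>seq_compact ?K\<close>, of "\<lambda>n. coord (f n)"] by blast
    then have pt: "(\<lambda>n. coord (f (r n)) k) \<longlonglongrightarrow> l k" for k
      using continuous_on_tendsto_compose[OF continuous_on_product_coordinates[of k]]
      by (force simp: o_def)
    have "\<bar>l k\<bar> \<le> \<gamma> k" for k using l by (auto simp: abs_le_iff PiE_iff minus_le_iff)
    moreover from this have c: "coord (Abs_c0 l) = l" by (rule coord_Abs_c0_dominated[OF lim])
    ultimately have "Abs_c0 l \<in> box_set \<gamma>" by (simp add: box_set_def)
    moreover from this f c pt have "(f \<circ> r) \<longlonglongrightarrow> Abs_c0 l"
      by (intro box_set_tendstoI[OF lim]) auto
    ultimately show "\<exists>l\<in>box_set \<gamma>. \<exists>r. strict_mono r \<and> (f \<circ> r) \<longlonglongrightarrow> l" using r by blast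
  qed
qed

text \<open>The coordinatewise nearest point of the inner box.\<close>
definition clip :: "(nat \<Rightarrow> real) \<Rightarrow> real \<Rightarrow> c0 \<Rightarrow> c0" where
  "clip \<gamma> \<delta> x = Abs_c0 (\<lambda>k. let b = max (\<gamma> k - \<delta>) 0 in max (- b) (min b (coord x k)))"

lemma coord_clip: "coord (clip \<gamma> \<delta> x) k = (let b = max (\<gamma> k - \<delta>) 0 in max (- b) (min b (coord x k)))"
proof -
  have "coord (clip \<gamma> \<delta> x) = (\<lambda>k. let b = max (\<gamma> k - \<delta>) 0 in max (- b) (min b (coord x k)))"
    unfolding clip_def
    by (rule coord_Abs_c0_dominated[OF tendsto_rabs_zero[OF coord_tendsto_0[of x]]])
      (auto simp: Let_def)
  then show ?thesis by simp
qed

lemma clip_in_inner_box_set: "clip \<gamma> \<delta> x \<in> inner_box_set \<gamma> \<delta>"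
  by (auto simp: inner_box_set_def coord_clip Let_def)

lemma dist_clip_le:
  assumes "x \<in> box_set \<gamma>" "\<delta> \<ge> 0" shows "dist (clip \<gamma> \<delta> x) x \<le> \<delta>"
  unfolding dist_norm
proof (rule norm_c0_leI)
  fix k 
  have "\<bar>coord x k\<bar> \<le> \<gamma> k" using assms by (auto simp: box_set_def)
  then show "\<bar>coord (clip \<gamma> \<delta> x - x) k\<bar> \<le> \<delta>"
    using assms(2) unfolding coord_simps coord_clip Let_def by linarith
qed

lemma inner_box_subset: "(\<And>k. \<gamma> k \<ge> 0) \<Longrightarrow> \<delta> \<ge> 0 \<Longrightarrow> inner_box_set \<gamma> \<delta> \<subseteq> box_set \<gamma>"
  unfolding inner_box_set_def box_set_def
  by (smt (verit) Collect_mono_iff)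

section \<open>Small balls under the uniform prior\<close>

lemma uniform_interval_mass:
  fixes g d x :: real
  assumes "0 < g" "0 < d"
  shows "measure (uniform_measure lborel {-1..1}) {t. \<bar>g * t - x\<bar> < d} \<le> d / g"
    and "\<bar>x\<bar> + d \<le> g \<Longrightarrow> measure (uniform_measure lborel {-1..1}) {t. \<bar>g * t - x\<bar> < d} = d / g"
proof -
  let ?I = "{(x - d) / g <..< (x + d) / g}"
  have eq: "{t. \<bar>g * t - x\<bar> < d} = ?I"
    using assms by (auto simp: field_simps abs_less_iff)
  have len: "measure lborel ?I = 2 * (d / g)"
    using assms by (subst measure_lborel_Ioo) (auto simp: field_simps)
  have m: "measure (uniform_measure lborel {-1..1}) ?I = measure lborel ({-1..1} \<inter> ?I) / 2"
    by (subst measure_uniform_measure) auto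
  have "measure lborel ({-1..1} \<inter> ?I) \<le> measure lborel ?I"
    by (intro measure_mono_fmeasurable) (auto simp: fmeasurable_def intro: emeasure_bounded_finite[simplified])
  then show "measure (uniform_measure lborel {-1..1}) {t. \<bar>g * t - x\<bar> < d} \<le> d / g"
    unfolding eq m len by linarith
  assume "\<bar>x\<bar> + d \<le> g"
  then have "-1 \<le> (x - d) / g" "(x + d) / g \<le> 1" using assms by (auto simp: field_simps abs_if split: if_splits)
  then have "{-1..1} \<inter> ?I = ?I" by auto
  then show "measure (uniform_measure lborel {-1..1}) {t. \<bar>g * t - x\<bar> < d} = d / g"
    using eq m len by simp
qed

text \<open>
  The prior mass of a ball of radius \<open>\<delta>\<close> centred in the inner box. Sides shorter than \<open>\<delta>\<close> are
  swallowed whole by such a ball and contribute a factor 1, so they are left out; since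
  the sides tend to zero, the product is finite and stays positive.
\<close>
definition small_ball_mass :: "(nat \<Rightarrow> real) \<Rightarrow> real \<Rightarrow> real" where
  "small_ball_mass \<gamma> \<delta> = (\<Prod>k | \<delta> \<le> \<gamma> k. \<delta> / \<gamma> k)"

lemma small_ball_mass_pos: "\<delta> > 0 \<Longrightarrow> small_ball_mass \<gamma> \<delta> > 0"
  unfolding small_ball_mass_def by (intro prod_pos) auto

locale uniform_box_prior =
  fixes \<gamma> :: "nat \<Rightarrow> real" and P :: "'w measure" and \<xi> :: "nat \<Rightarrow> 'w \<Rightarrow> real"
  assumes gamma_nonneg: "\<And>k. \<gamma> k \<ge> 0"
    and gamma_lim: "\<gamma> \<longlonglongrightarrow> 0"
    and xi: "uniform_iid P \<xi>"
begin

abbreviation "prior \<equiv> uniform_prior P \<xi> \<gamma>"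

sublocale P: prob_space P using xi by (simp add: uniform_iid_def)

lemma xi_measurable [measurable]: "\<xi> k \<in> borel_measurable P"
  using xi by (auto simp: uniform_iid_def P.indep_vars_def)

lemma AE_abs_xi_le_1: "AE \<omega> in P. \<forall>k. \<bar>\<xi> k \<omega>\<bar> \<le> 1"
proof -
  have "AE \<omega> in P. \<bar>\<xi> k \<omega>\<bar> \<le> 1" for k
  proof (rule AE_distrD[where M' = borel and f = "\<xi> k" and P = "\<lambda>t. \<bar>t\<bar> \<le> 1"])
    have "distr P borel (\<xi> k) = uniform_measure lborel {-1..1}" using xi by (simp add: uniform_iid_def)
    then show "AE t in distr P borel (\<xi> k). \<bar>t\<bar> \<le> 1"
      by (simp only:) (rule AE_uniform_measureI, simp, rule AE_I2, auto)
  qed simp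
  then show ?thesis by (simp add: AE_all_countable)
qed

text \<open>Partial sums only replace coordinates by zero, so they stay in the box, where coordinatewise
  convergence suffices.\<close>
lemma sums_unit_vec:
  assumes "x \<in> box_set \<gamma>" shows "(\<lambda>k. coord x k *\<^sub>R unit_vec k) sums x"
  unfolding sums_def
proof (rule box_set_tendstoI[OF gamma_lim _ assms])
  have c: "coord (\<Sum>k<n. coord x k *\<^sub>R unit_vec k) j = (if j < n then coord x j else 0)" for n j
    by (simp add: if_distrib[where f="\<lambda>t. _ * t"] cong: if_cong)
  show "(\<Sum>k<n. coord x k *\<^sub>R unit_vec k) \<in> box_set \<gamma>" for n
    using assms gamma_nonneg unfolding box_set_def mem_Collect_eq c by auto
  show "(\<lambda>n. coord (\<Sum>k<n. coord x k *\<^sub>R unit_vec k) j) \<longlonglongrightarrow> coord x j" for j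
    unfolding c by (rule tendsto_eventually) (auto simp: eventually_sequentially intro!: exI[of _ "Suc j"])
qed

text \<open>Outside a null set, every summation of the random series succeeds: the bounds \<open>\<bar>\<xi> k\<bar> \<le> 1\<close> put
  the candidate limit in the box. All later facts about the prior rest on these two properties of
  the sum.\<close>
lemma AE_series:
  "AE \<omega> in P. (\<Sum>k. (\<gamma> k * \<xi> k \<omega>) *\<^sub>R unit_vec k) \<in> box_set \<gamma> \<and>
     (\<forall>k. coord (\<Sum>k. (\<gamma> k * \<xi> k \<omega>) *\<^sub>R unit_vec k) k = \<gamma> k * \<xi> k \<omega>)"
  using AE_abs_xi_le_1
proof eventually_elim
  case (elim \<omega>)
  define x where "x = Abs_c0 (\<lambda>k. \<gamma> k * \<xi> k \<omega>)"
  have b: "\<bar>\<gamma> k * \<xi> k \<omega>\<bar> \<le> \<gamma> k" for k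
    using elim gamma_nonneg[of k] mult_left_mono[of "\<bar>\<xi> k \<omega>\<bar>" 1 "\<gamma> k"] by (simp add: abs_mult)
  have x: "coord x = (\<lambda>k. \<gamma> k * \<xi> k \<omega>)"
    unfolding x_def by (rule coord_Abs_c0_dominated[OF gamma_lim b])
  have mem: "x \<in> box_set \<gamma>" using b by (simp add: box_set_def x)
  have "(\<Sum>k. (\<gamma> k * \<xi> k \<omega>) *\<^sub>R unit_vec k) = x"
    using sums_unique[OF sums_unit_vec[OF mem]] by (simp add: x)
  then show ?case using mem x by simp
qed

lemma prior_measurable [measurable]:
  "(\<lambda>\<omega>. \<Sum>k. (\<gamma> k * \<xi> k \<omega>) *\<^sub>R unit_vec k) \<in> borel_measurable P"
  by (rule measurable_uniform_series[OF xi])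

lemma sets_prior [measurable_cong, simp]: "sets prior = sets borel"
  by (simp add: uniform_prior_def)

sublocale prior: prob_space prior
  unfolding uniform_prior_def by (rule P.prob_space_distr) simp

lemma closed_box_set: "closed (box_set \<gamma>)"
  using compact_box_set[OF gamma_lim] by (rule compact_imp_closed)

lemma AE_prior_box: "AE x in prior. x \<in> box_set \<gamma>"
  unfolding uniform_prior_def
proof (subst AE_distr_iff)
  show "{x \<in> space borel. x \<in> box_set \<gamma>} \<in> sets borel"
    using closed_box_set by simp
  show "AE \<omega> in P. (\<Sum>k. (\<gamma> k * \<xi> k \<omega>) *\<^sub>R unit_vec k) \<in> box_set \<gamma>"
    using AE_series by eventually_elim blast
qed simp

lemma finite_large_sides: "\<delta> > 0 \<Longrightarrow> finite {k. \<delta> \<le> \<gamma> k}"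
proof -
  assume "\<delta> > 0"
  then obtain N where N: "\<And>k. k \<ge> N \<Longrightarrow> \<gamma> k < \<delta>"
    using order_tendstoD(2)[OF gamma_lim, of \<delta>] by (auto simp: eventually_sequentially)
  have "k < N" if "\<delta> \<le> \<gamma> k" for k
    using N[of k] that by linarith
  then have "{k. \<delta> \<le> \<gamma> k} \<subseteq> {..<N}" by blast
  then show ?thesis by (rule finite_subset) simp
qed

lemma prob_finite_box:
  assumes "finite F"
  shows "P.prob {\<omega> \<in> space P. \<forall>k\<in>F. \<bar>\<gamma> k * \<xi> k \<omega> - coord x k\<bar> < \<delta>} =
     (\<Prod>k\<in>F. measure (uniform_measure lborel {-1..1}) {t. \<bar>\<gamma> k * t - coord x k\<bar> < \<delta>})"
proof (cases "F = {}")
  case True then show ?thesis by (simp add: P.prob_space)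
next
  case False
  let ?A = "\<lambda>k. {t. \<bar>\<gamma> k * t - coord x k\<bar> < \<delta>}"
  have [measurable]: "?A k \<in> sets borel" for k by measurable
  have ind: "P.indep_vars (\<lambda>_. borel) \<xi> UNIV" and
    d: "distr P borel (\<xi> k) = uniform_measure lborel {-1..1}" for k
    using xi by (auto simp: uniform_iid_def)
  have "{\<omega> \<in> space P. \<forall>k\<in>F. \<bar>\<gamma> k * \<xi> k \<omega> - coord x k\<bar> < \<delta>} = (\<Inter>k\<in>F. \<xi> k -` ?A k \<inter> space P)"
    using False by auto
  also have "P.prob \<dots> = (\<Prod>k\<in>F. P.prob (\<xi> k -` ?A k \<inter> space P))"
    using False assms by (intro P.indep_varsD[OF ind]) auto
  also have "\<dots> = (\<Prod>k\<in>F. measure (distr P borel (\<xi> k)) (?A k))"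
    by (intro prod.cong refl) (simp add: measure_distr)
  finally show ?thesis by (simp add: d)
qed

text \<open>Dropping the constraints on the short sides enlarges the ball to an event about finitely many
  independent coordinates.\<close>
lemma prior_ball_le:
  assumes "\<delta> > 0" shows "prior.prob (ball x \<delta>) \<le> small_ball_mass \<gamma> \<delta>"
proof -
  let ?S = "\<lambda>\<omega>. \<Sum>k. (\<gamma> k * \<xi> k \<omega>) *\<^sub>R unit_vec k"
  let ?F = "{k. \<delta> \<le> \<gamma> k}"
  let ?A = "{\<omega> \<in> space P. \<forall>k\<in>?F. \<bar>\<gamma> k * \<xi> k \<omega> - coord x k\<bar> < \<delta>}"
  have fin: "finite ?F" by (rule finite_large_sides[OF assms])
  have [measurable]: "?A \<in> sets P" using fin by measurable
  have "prior.prob (ball x \<delta>) = P.prob (?S -` ball x \<delta> \<inter> space P)"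
    unfolding uniform_prior_def by (rule measure_distr) auto
  also have "\<dots> \<le> P.prob ?A"
  proof (rule P.finite_measure_mono_AE)
    show "AE \<omega> in P. \<omega> \<in> ?S -` ball x \<delta> \<inter> space P \<longrightarrow> \<omega> \<in> ?A"
      using AE_series
    proof eventually_elim
      case (elim \<omega>)
      then show ?case using mem_ball_iff_coord[OF assms, of "?S \<omega>" x] by auto
    qed
  qed fact
  also have "\<dots> \<le> small_ball_mass \<gamma> \<delta>"
    unfolding prob_finite_box[OF fin] small_ball_mass_def
    using assms by (intro prod_mono conjI measure_nonneg uniform_interval_mass(1)) auto
  finally show ?thesis .
qed

text \<open>On a short side the centre has coordinate 0 and the prior never leaves distance \<open>\<delta>\<close>, so that
  dropping the constraint loses nothing; on a long side the whole interval of radius \<open>\<delta>\<close> fits into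
  the box, so that its mass is the largest possible.\<close>
lemma prior_ball_eq:
  assumes "\<delta> > 0" "x \<in> inner_box_set \<gamma> \<delta>" shows "prior.prob (ball x \<delta>) = small_ball_mass \<gamma> \<delta>"
proof (rule antisym[OF prior_ball_le[OF assms(1)]])
  let ?S = "\<lambda>\<omega>. \<Sum>k. (\<gamma> k * \<xi> k \<omega>) *\<^sub>R unit_vec k"
  let ?F = "{k. \<delta> \<le> \<gamma> k}"
  let ?A = "{\<omega> \<in> space P. \<forall>k\<in>?F. \<bar>\<gamma> k * \<xi> k \<omega> - coord x k\<bar> < \<delta>}"
  have x: "\<bar>coord x k\<bar> \<le> max (\<gamma> k - \<delta>) 0" for k using assms(2) by (simp add: inner_box_set_def)
  have fin: "finite ?F" by (rule finite_large_sides[OF assms(1)])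
  have "small_ball_mass \<gamma> \<delta> = P.prob ?A"
    unfolding prob_finite_box[OF fin] small_ball_mass_def
  proof (intro prod.cong refl uniform_interval_mass(2)[symmetric])
    fix k assume "k \<in> ?F"
    then show "0 < \<gamma> k" "0 < \<delta>" "\<bar>coord x k\<bar> + \<delta> \<le> \<gamma> k" using assms x[of k] by auto
  qed
  also have "\<dots> \<le> P.prob (?S -` ball x \<delta> \<inter> space P)"
  proof (rule P.finite_measure_mono_AE)
    show "AE \<omega> in P. \<omega> \<in> ?A \<longrightarrow> \<omega> \<in> ?S -` ball x \<delta> \<inter> space P"
      using AE_series AE_space
    proof eventually_elim
      case (elim \<omega>)
      have "\<bar>coord (?S \<omega>) k - coord x k\<bar> < \<delta>" if "\<omega> \<in> ?A" for k
      proof (cases "\<delta> \<le> \<gamma> k")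
        case False
        then have "coord x k = 0" using x[of k] by simp
        moreover have "\<bar>coord (?S \<omega>) k\<bar> \<le> \<gamma> k" using elim unfolding box_set_def by blast
        ultimately show ?thesis using False by linarith
      qed (use that elim in auto)
      then show ?case using mem_ball_iff_coord[OF assms(1), of "?S \<omega>" x] elim by blast
    qed
    show "?S -` ball x \<delta> \<inter> space P \<in> P.events" by measurable
  qed
  also have "\<dots> = prior.prob (ball x \<delta>)"
    unfolding uniform_prior_def by (rule measure_distr[symmetric]) auto
  finally show "small_ball_mass \<gamma> \<delta> \<le> prior.prob (ball x \<delta>)" .
qed

end

section \<open>Small balls under the posterior\<close>

locale uniform_box_posterior = uniform_box_prior +
  fixes \<Phi> :: "c0 \<Rightarrow> real"
  assumes Z_pos: "0 < normalization_const prior \<Phi>"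
    and Z_fin: "normalization_const prior \<Phi> < \<infinity>"
    and lip: "lipschitz_on_bounded_sets \<Phi>"
begin

abbreviation "post \<equiv> posterior prior \<Phi>"
abbreviation "Z \<equiv> enn2real (normalization_const prior \<Phi>)"
abbreviation "J \<delta> x \<equiv> measure post (ball x \<delta>)"

lemma Z_real_pos: "Z > 0"
  using Z_pos Z_fin by (simp add: enn2real_positive_iff)

lemma isCont_Phi: "isCont \<Phi> x"
proof -
  have "norm x + 1 > 0" by (simp add: add_nonneg_pos)
  then obtain L where L: "L > 0" and "\<And>y z. norm y \<le> norm x + 1 \<Longrightarrow> norm z \<le> norm x + 1 \<Longrightarrow> \<bar>\<Phi> y - \<Phi> z\<bar> \<le> L * norm (y - z)"
    using lip unfolding lipschitz_on_bounded_sets_def by blast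
  then have "L-lipschitz_on (ball 0 (norm x + 1)) \<Phi>"
    by (intro lipschitz_onI) (auto simp: dist_norm)
  then have "continuous_on (ball 0 (norm x + 1)) \<Phi>" by (rule lipschitz_on_continuous_on)
  then show ?thesis by (rule continuous_on_interior) (simp add: interior_open)
qed

lemma continuous_Phi: "continuous_on S \<Phi>"
  by (intro continuous_at_imp_continuous_on ballI isCont_Phi)

lemma Phi_measurable [measurable]: "\<Phi> \<in> borel_measurable borel"
  by (intro borel_measurable_continuous_onI continuous_Phi)

lemma sets_post [simp, measurable_cong]: "sets post = sets borel"
  by (simp add: posterior_def)

lemma emeasure_post:
  assumes "A \<in> sets borel"
  shows "emeasure post A = ennreal (1 / Z) * (\<integral>\<^sup>+ x. ennreal (exp (- \<Phi> x)) * indicator A x \<partial>prior)"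
proof -
  have "normalization_const prior \<Phi> = ennreal Z" using Z_fin by simp
  then have "1 / normalization_const prior \<Phi> = ennreal (1 / Z)"
    using Z_real_pos divide_ennreal[of 1 Z] by simp
  then show ?thesis using assms by (simp add: posterior_def emeasure_density)
qed

sublocale post: prob_space post
proof
  have *: "ennreal (1 / Z) * normalization_const prior \<Phi> = 1"
  proof -
    have "ennreal (1 / Z) * ennreal Z = 1"
      using Z_real_pos by (simp add: ennreal_mult'[symmetric])
    then show ?thesis using Z_fin by simp
  qed
  have "space post = UNIV" using sets_eq_imp_space_eq[OF sets_post] by simp
  then show "emeasure post (space post) = 1"
    using * by (simp add: emeasure_post normalization_const_def)
qed

text \<open>The prior charges only the box, hence bounds of the potential are needed only there.\<close>
lemma post_le:
  assumes A: "A \<in> sets borel" and "\<And>x. x \<in> A \<Longrightarrow> x \<in> box_set \<gamma> \<Longrightarrow> a \<le> \<Phi> x"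
  shows "post.prob A \<le> exp (- a) / Z * prior.prob A"
proof -
  have "emeasure post A \<le> ennreal (1 / Z) * (\<integral>\<^sup>+ x. ennreal (exp (- a)) * indicator A x \<partial>prior)"
    unfolding emeasure_post[OF A] using AE_prior_box assms(2)
    by (intro mult_left_mono nn_integral_mono_AE) (auto elim!: eventually_mono simp: indicator_def)
  also have "\<dots> = ennreal (exp (- a) / Z * prior.prob A)"
    using A Z_real_pos
    by (simp add: nn_integral_cmult_indicator prior.emeasure_eq_measure ennreal_mult'[symmetric])
  finally show ?thesis using Z_real_pos
    by (simp add: post.emeasure_eq_measure ennreal_le_iff)
qed

lemma post_ge:
  assumes A: "A \<in> sets borel" and "\<And>x. x \<in> A \<Longrightarrow> x \<in> box_set \<gamma> \<Longrightarrow> \<Phi> x \<le> a"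
  shows "exp (- a) / Z * prior.prob A \<le> post.prob A"
proof -
  have "ennreal (exp (- a) / Z * prior.prob A) =
      ennreal (1 / Z) * (\<integral>\<^sup>+ x. ennreal (exp (- a)) * indicator A x \<partial>prior)"
    using A Z_real_pos
    by (simp add: nn_integral_cmult_indicator prior.emeasure_eq_measure ennreal_mult'[symmetric])
  also have "\<dots> \<le> emeasure post A"
    unfolding emeasure_post[OF A] using AE_prior_box assms(2)
    by (intro mult_left_mono nn_integral_mono_AE) (auto elim!: eventually_mono simp: indicator_def)
  finally show ?thesis
    by (simp add: post.emeasure_eq_measure ennreal_le_iff)
qed

lemma zero_in_box: "0 \<in> box_set \<gamma>"
  using gamma_nonneg by (simp add: box_set_def)

definition minimizer :: "c0 \<Rightarrow> bool" where
  "minimizer x \<longleftrightarrow> x \<in> box_set \<gamma> \<and> (\<forall>y\<in>box_set \<gamma>. \<Phi> x \<le> \<Phi> y)"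

text \<open>Outside the box the functional is infinite; a point there is not minimal because the box
  contains 0, where the value is finite.\<close>
lemma is_arg_min_functional_I: "is_arg_min (functional_I \<Phi> \<gamma>) (\<lambda>_. True) x \<longleftrightarrow> minimizer x"
proof -
  have "x \<in> box_set \<gamma>" if "\<forall>y. \<not> functional_I \<Phi> \<gamma> y < functional_I \<Phi> \<gamma> x"
    using that[rule_format, of 0] zero_in_box by (auto simp: functional_I_def split: if_splits)
  then show ?thesis
    unfolding is_arg_min_def minimizer_def
    using zero_in_box by (auto simp: functional_I_def not_less split: if_splits)
qed

lemma minimizer_exists: "\<exists>x. minimizer x"
  unfolding minimizer_def using continuous_attains_inf[OF compact_box_set[OF gamma_lim] _ continuous_Phi]
    zero_in_box by blast

text \<open>Centres of balls that meet the box may lie outside it, so the Lipschitz constant is taken on a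
  ball that contains the unit neighbourhood of the (bounded) box.\<close>
lemma lipschitz_near_box:
  "\<exists>L>0. \<forall>x\<in>box_set \<gamma>. \<forall>w. dist x w \<le> 1 \<longrightarrow> \<bar>\<Phi> x - \<Phi> w\<bar> \<le> L * dist x w"
proof -
  obtain G where G: "\<And>x. x \<in> box_set \<gamma> \<Longrightarrow> norm x \<le> G"
    using compact_imp_bounded[OF compact_box_set[OF gamma_lim]] by (auto simp: bounded_iff)
  have "0 \<le> G" using G[OF zero_in_box] by simp
  then obtain L where L: "L > 0"
      "\<And>y z. norm y \<le> G + 1 \<Longrightarrow> norm z \<le> G + 1 \<Longrightarrow> \<bar>\<Phi> y - \<Phi> z\<bar> \<le> L * norm (y - z)"
    using lip unfolding lipschitz_on_bounded_sets_def by (meson add_nonneg_pos zero_less_one)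
  have "\<bar>\<Phi> x - \<Phi> w\<bar> \<le> L * dist x w" if "x \<in> box_set \<gamma>" "dist x w \<le> 1" for x w
    unfolding dist_norm
  proof (rule L(2))
    show "norm x \<le> G + 1" using G[OF that(1)] by simp
    show "norm w \<le> G + 1"
      using G[OF that(1)] that(2) norm_triangle_ineq3[of x w] by (simp add: dist_norm)
  qed
  then show ?thesis using L(1) by blast
qed

lemma ball_mass_le_of_minimizer:
  assumes "\<delta> > 0" "minimizer x" shows "J \<delta> w \<le> exp (- \<Phi> x) / Z * small_ball_mass \<gamma> \<delta>"
proof -
  have "J \<delta> w \<le> exp (- \<Phi> x) / Z * prior.prob (ball w \<delta>)"
    using assms(2) by (intro post_le) (auto simp: minimizer_def)
  also have "\<dots> \<le> exp (- \<Phi> x) / Z * small_ball_mass \<gamma> \<delta>"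
    using Z_real_pos by (intro mult_left_mono prior_ball_le assms) simp
  finally show ?thesis .
qed

context
  fixes L :: real
  assumes L_pos: "L > 0"
    and L: "\<And>x w. x \<in> box_set \<gamma> \<Longrightarrow> dist x w \<le> 1 \<Longrightarrow> \<bar>\<Phi> x - \<Phi> w\<bar> \<le> L * dist x w"
begin

lemma Phi_diff_le:
  assumes "x \<in> box_set \<gamma>" "dist x w \<le> \<delta>" "\<delta> \<le> 1" shows "\<bar>\<Phi> x - \<Phi> w\<bar> \<le> L * \<delta>"
proof -
  have "\<bar>\<Phi> x - \<Phi> w\<bar> \<le> L * dist x w" using assms by (intro L) auto
  also have "\<dots> \<le> L * \<delta>" using L_pos assms by simp
  finally show ?thesis .
qed

lemma ball_mass_le_center:
  assumes "0 < \<delta>" "\<delta> \<le> 1"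
  shows "J \<delta> w \<le> exp (L * \<delta> - \<Phi> w) / Z * small_ball_mass \<gamma> \<delta>"
proof -
  have "J \<delta> w \<le> exp (- (\<Phi> w - L * \<delta>)) / Z * prior.prob (ball w \<delta>)"
  proof (rule post_le)
    fix x assume "x \<in> ball w \<delta>" "x \<in> box_set \<gamma>"
    then show "\<Phi> w - L * \<delta> \<le> \<Phi> x"
      using Phi_diff_le[of x w \<delta>] assms by (simp add: dist_commute)
  qed simp
  also have "\<dots> \<le> exp (- (\<Phi> w - L * \<delta>)) / Z * small_ball_mass \<gamma> \<delta>"
    using Z_real_pos by (intro mult_left_mono prior_ball_le assms) simp
  finally show ?thesis by simp
qed

lemma ball_mass_clip_ge:
  assumes "0 < \<delta>" "\<delta> \<le> 1" "x \<in> box_set \<gamma>"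
  shows "exp (- \<Phi> x - 2 * L * \<delta>) / Z * small_ball_mass \<gamma> \<delta> \<le> J \<delta> (clip \<gamma> \<delta> x)"
proof -
  let ?w = "clip \<gamma> \<delta> x"
  have x: "\<bar>\<Phi> x - \<Phi> ?w\<bar> \<le> L * \<delta>"
    using assms dist_clip_le[of x \<gamma> \<delta>] by (intro Phi_diff_le) (auto simp: dist_commute)
  have "exp (- (\<Phi> x + 2 * L * \<delta>)) / Z * prior.prob (ball ?w \<delta>) \<le> J \<delta> ?w"
  proof (rule post_ge)
    fix z assume "z \<in> ball ?w \<delta>" "z \<in> box_set \<gamma>"
    then show "\<Phi> z \<le> \<Phi> x + 2 * L * \<delta>"
      using Phi_diff_le[of z ?w \<delta>] x assms by (simp add: dist_commute)
  qed simp
  then show ?thesis by (simp add: prior_ball_eq[OF assms(1) clip_in_inner_box_set])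
qed

lemma ball_mass_le_sup: "J \<delta> w \<le> sup_ball_mass post \<delta>"
  unfolding sup_ball_mass_def
  by (rule cSUP_upper) (auto intro!: bdd_aboveI[of _ 1])

text \<open>The largest ball mass is known up to a factor \<open>exp (2 * L * \<delta>)\<close>: it is attained approximately
  at a minimizer moved into the inner box.\<close>
lemma sup_ball_mass_bounds:
  assumes "0 < \<delta>" "\<delta> \<le> 1" "minimizer x"
  shows "exp (- \<Phi> x - 2 * L * \<delta>) / Z * small_ball_mass \<gamma> \<delta> \<le> sup_ball_mass post \<delta>"
    and "sup_ball_mass post \<delta> \<le> exp (- \<Phi> x) / Z * small_ball_mass \<gamma> \<delta>"
    and "0 < sup_ball_mass post \<delta>"
proof -
  show 1: "exp (- \<Phi> x - 2 * L * \<delta>) / Z * small_ball_mass \<gamma> \<delta> \<le> sup_ball_mass post \<delta>"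
    using ball_mass_clip_ge[OF assms(1,2)] assms(3) ball_mass_le_sup order_trans unfolding minimizer_def by blast
  show "sup_ball_mass post \<delta> \<le> exp (- \<Phi> x) / Z * small_ball_mass \<gamma> \<delta>"
    unfolding sup_ball_mass_def using ball_mass_le_of_minimizer[OF assms(1,3)] by (intro cSUP_least) auto
  have "0 < exp (- \<Phi> x - 2 * L * \<delta>) / Z * small_ball_mass \<gamma> \<delta>"
    using Z_real_pos small_ball_mass_pos[OF assms(1)] by simp
  then show "0 < sup_ball_mass post \<delta>" using 1 by linarith
qed

section \<open>Modes and minimizers\<close>

text \<open>A maximizer does at least as well as a minimizer moved into the inner box; comparing the upper
  bound for the former with the lower bound for the latter cancels the ball mass of the prior.\<close>
lemma Phi_maximizer_le:
  assumes "0 < \<delta>" "\<delta> \<le> 1" "minimizer x"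
    and "is_arg_max (J \<delta>) (\<lambda>x. x \<in> inner_box_set \<gamma> \<delta>) w"
  shows "\<Phi> w \<le> \<Phi> x + 3 * L * \<delta>"
proof -
  have "J \<delta> (clip \<gamma> \<delta> x) \<le> J \<delta> w"
    using assms(4) clip_in_inner_box_set by (auto simp: is_arg_max_def not_less)
  then have "exp (- \<Phi> x - 2 * L * \<delta>) / Z * small_ball_mass \<gamma> \<delta> \<le> exp (L * \<delta> - \<Phi> w) / Z * small_ball_mass \<gamma> \<delta>"
    using ball_mass_clip_ge[OF assms(1,2), of x] ball_mass_le_center[OF assms(1,2), of w] assms(3) by (auto simp: minimizer_def)
  then have "exp (- \<Phi> x - 2 * L * \<delta>) \<le> exp (L * \<delta> - \<Phi> w)"
    using Z_real_pos small_ball_mass_pos[OF assms(1)] by (simp add: divide_le_cancel)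
  then show ?thesis by simp
qed

lemma ball_mass_ratio_le:
  assumes "0 < \<delta>" "\<delta> \<le> 1" "minimizer x"
  shows "J \<delta> w / sup_ball_mass post \<delta> \<le> exp (\<Phi> x - \<Phi> w + 3 * L * \<delta>)"
proof -
  let ?c = "small_ball_mass \<gamma> \<delta> / Z"
  have "J \<delta> w \<le> exp (L * \<delta> - \<Phi> w) * ?c"
    using ball_mass_le_center[OF assms(1,2)] by simp
  also have "\<dots> = exp (\<Phi> x - \<Phi> w + 3 * L * \<delta>) * (exp (- \<Phi> x - 2 * L * \<delta>) * ?c)"
    by (simp add: exp_add[symmetric] mult.assoc[symmetric])
  also have "\<dots> \<le> exp (\<Phi> x - \<Phi> w + 3 * L * \<delta>) * sup_ball_mass post \<delta>"
    using sup_ball_mass_bounds(1)[OF assms] by (intro mult_left_mono) auto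
  finally show ?thesis
    using sup_ball_mass_bounds(3)[OF assms] by (simp add: pos_divide_le_eq)
qed

lemma ball_mass_ratio_clip_ge:
  assumes "0 < \<delta>" "\<delta> \<le> 1" "minimizer x"
  shows "exp (- (2 * L * \<delta>)) \<le> J \<delta> (clip \<gamma> \<delta> x) / sup_ball_mass post \<delta>"
proof -
  let ?c = "small_ball_mass \<gamma> \<delta> / Z"
  have "exp (- (2 * L * \<delta>)) * sup_ball_mass post \<delta> \<le> exp (- (2 * L * \<delta>)) * (exp (- \<Phi> x) * ?c)"
    using sup_ball_mass_bounds(2)[OF assms] by (intro mult_left_mono) auto
  also have "\<dots> = exp (- \<Phi> x - 2 * L * \<delta>) * ?c"
    by (simp add: exp_add[symmetric] mult.assoc[symmetric])
  also have "\<dots> \<le> J \<delta> (clip \<gamma> \<delta> x)"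
    using ball_mass_clip_ge[OF assms(1,2), of x] assms(3) by (simp add: minimizer_def)
  finally show ?thesis
    using sup_ball_mass_bounds(3)[OF assms] by (simp add: pos_le_divide_eq)
qed

lemma limit_of_maximizers:
  assumes d: "\<And>n. \<delta> n > 0" "\<delta> \<longlonglongrightarrow> 0"
    and w: "\<And>n. is_arg_max (J (\<delta> n)) (\<lambda>x. x \<in> inner_box_set \<gamma> (\<delta> n)) (w n)"
    and lim: "w \<longlonglongrightarrow> x" and x: "x \<in> box_set \<gamma>"
  shows "minimizer x"
proof -
  obtain x0 where x0: "minimizer x0" using minimizer_exists by blast
  have "\<forall>\<^sub>F n in sequentially. \<delta> n < 1" using d(2) by (rule order_tendstoD) simp
  then have "\<forall>\<^sub>F n in sequentially. \<Phi> (w n) \<le> \<Phi> x0 + 3 * L * \<delta> n"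
    by eventually_elim (intro Phi_maximizer_le d x0 w, simp)
  moreover have "(\<lambda>n. \<Phi> (w n)) \<longlonglongrightarrow> \<Phi> x" by (rule isCont_tendsto_compose[OF isCont_Phi lim])
  moreover have "(\<lambda>n. \<Phi> x0 + 3 * L * \<delta> n) \<longlonglongrightarrow> \<Phi> x0 + 3 * L * 0" by (intro tendsto_intros d)
  ultimately have "\<Phi> x \<le> \<Phi> x0 + 3 * L * 0"
    by (intro tendsto_le[OF trivial_limit_sequentially])
  then show ?thesis using x0 x by (fastforce simp: minimizer_def)
qed

text \<open>A minimizer on the boundary of the box is itself a poor centre, since a ball around it sticks
  out of the box. This is why the approximating centres are moved into the inner box.\<close>
lemma minimizer_imp_mode:
  assumes "minimizer x" shows "generalized_mode post x"
  unfolding generalized_mode_def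
proof (intro allI impI)
  fix \<delta> :: "nat \<Rightarrow> real" assume "(\<forall>n. \<delta> n > 0) \<and> \<delta> \<longlonglongrightarrow> 0"
  then have d: "\<And>n. \<delta> n > 0" "\<delta> \<longlonglongrightarrow> 0" by auto
  have e: "\<forall>\<^sub>F n in sequentially. \<delta> n < 1" using d(2) by (rule order_tendstoD) simp
  let ?w = "\<lambda>n. clip \<gamma> (\<delta> n) x"
  have "?w \<longlonglongrightarrow> x"
  proof (rule metric_tendsto_imp_tendsto[OF d(2)])
    show "\<forall>\<^sub>F n in sequentially. dist (?w n) x \<le> dist (\<delta> n) 0"
      using assms dist_clip_le[of x \<gamma>] less_imp_le[OF d(1)] by (auto simp: minimizer_def dist_real_def intro!: always_eventually)
  qed
  moreover have "(\<lambda>n. J (\<delta> n) (?w n) / sup_ball_mass post (\<delta> n)) \<longlonglongrightarrow> 1"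
  proof (rule tendsto_sandwich)
    show "\<forall>\<^sub>F n in sequentially. exp (- (2 * L * \<delta> n)) \<le> J (\<delta> n) (?w n) / sup_ball_mass post (\<delta> n)"
      using e by eventually_elim (intro ball_mass_ratio_clip_ge d assms, simp)
    show "\<forall>\<^sub>F n in sequentially. J (\<delta> n) (?w n) / sup_ball_mass post (\<delta> n) \<le> 1"
      using e
    proof eventually_elim
      case (elim n)
      have "0 < sup_ball_mass post (\<delta> n)"
        using elim by (intro sup_ball_mass_bounds(3)[OF _ _ assms] d) simp
      then show ?case using ball_mass_le_sup by simp
    qed
    have "(\<lambda>n. exp (- (2 * L * \<delta> n))) \<longlonglongrightarrow> exp (- (2 * L * 0))" by (intro tendsto_intros d)
    then show "(\<lambda>n. exp (- (2 * L * \<delta> n))) \<longlonglongrightarrow> 1" by simp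
  qed auto
  ultimately show "\<exists>w. w \<longlonglongrightarrow> x \<and> (\<lambda>n. J (\<delta> n) (w n) / sup_ball_mass post (\<delta> n)) \<longlonglongrightarrow> 1"
    by blast
qed

text \<open>A ball of positive mass meets the box, so the approximating centres, and with them the mode,
  approach the closed box. Along these centres the ratio of masses would stay below
  \<open>exp (m - \<Phi> x) < 1\<close> in the limit if the value at the mode exceeded the minimum \<open>m\<close>.\<close>
lemma mode_imp_minimizer:
  assumes "generalized_mode post x" shows "minimizer x"
proof -
  obtain x0 where x0: "minimizer x0" using minimizer_exists by blast
  (* Any one null sequence of radii is enough; starting at 1 keeps the Lipschitz bound available. *)
  define \<delta> :: "nat \<Rightarrow> real" where "\<delta> n = 1 / real (Suc n)" for n
  have d: "\<And>n. \<delta> n > 0" "\<And>n. \<delta> n \<le> 1" "\<delta> \<longlonglongrightarrow> 0"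
    unfolding \<delta>_def using LIMSEQ_inverse_real_of_nat by (auto simp: inverse_eq_divide)
  then obtain w where w: "w \<longlonglongrightarrow> x" and ratio: "(\<lambda>n. J (\<delta> n) (w n) / sup_ball_mass post (\<delta> n)) \<longlonglongrightarrow> 1"
    using assms unfolding generalized_mode_def by blast
  have Phi_w: "(\<lambda>n. \<Phi> (w n)) \<longlonglongrightarrow> \<Phi> x" by (rule isCont_tendsto_compose[OF isCont_Phi w])
  have "(\<lambda>n. exp (\<Phi> x0 - \<Phi> (w n) + 3 * L * \<delta> n)) \<longlonglongrightarrow> exp (\<Phi> x0 - \<Phi> x + 3 * L * 0)"
    by (intro tendsto_intros Phi_w d)
  then have "1 \<le> exp (\<Phi> x0 - \<Phi> x + 3 * L * 0)"
    using ratio ball_mass_ratio_le[OF d(1,2) x0]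
    by (intro tendsto_le[OF trivial_limit_sequentially]) (auto intro!: always_eventually)
  then have le: "\<Phi> x \<le> \<Phi> x0" by simp
  have "\<forall>\<^sub>F n in sequentially. infdist (w n) (box_set \<gamma>) \<le> \<delta> n"
    using order_tendstoD(1)[OF ratio zero_less_one]
  proof eventually_elim
    case (elim n)
    have "J (\<delta> n) (w n) \<le> 0" if "ball (w n) (\<delta> n) \<inter> box_set \<gamma> = {}"
    proof -
      have "prior.prob (ball (w n) (\<delta> n)) = 0"
        using AE_prior_box that by (subst prior.prob_eq_0) (auto elim!: eventually_mono)
      moreover have "J (\<delta> n) (w n) \<le> exp (- 0) / Z * prior.prob (ball (w n) (\<delta> n))"
        using that by (intro post_le) auto
      ultimately show ?thesis by simp
    qed
    then obtain z where "z \<in> ball (w n) (\<delta> n)" "z \<in> box_set \<gamma>"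
      using elim by (fastforce simp: zero_less_divide_iff measure_le_0_iff)
    then show ?case using infdist_le2[of z "box_set \<gamma>" "w n" "\<delta> n"] by simp
  qed
  then have "infdist x (box_set \<gamma>) \<le> 0"
    using w d(3) by (intro tendsto_le[OF trivial_limit_sequentially, of \<delta> _ "\<lambda>n. infdist (w n) (box_set \<gamma>)"] tendsto_infdist)
  then have "x \<in> box_set \<gamma>"
    using closed_box_set zero_in_box infdist_nonneg[of x "box_set \<gamma>"]
    by (subst in_closed_iff_infdist_zero) auto
  then show ?thesis using le x0 by (fastforce simp: minimizer_def)
qed

end

end

theorem theorem5p9:
  fixes \<gamma> :: "nat \<Rightarrow> real"
    and P :: "'w measure" and \<xi> :: "nat \<Rightarrow> 'w \<Rightarrow> real"
    and \<Phi> :: "c0 \<Rightarrow> real"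
    and \<mu>0 \<mu>y :: "c0 measure"
    and x\<delta> :: "real \<Rightarrow> c0"
  assumes gamma_nonneg: "\<And>k. \<gamma> k \<ge> 0"
    and gamma_lim: "\<gamma> \<longlonglongrightarrow> 0"
    and xi: "uniform_iid P \<xi>"
    and prior: "\<mu>0 = uniform_prior P \<xi> \<gamma>"
    and Z_pos: "0 < normalization_const \<mu>0 \<Phi>"
    and Z_fin: "normalization_const \<mu>0 \<Phi> < \<infinity>"
    and post: "\<mu>y = posterior \<mu>0 \<Phi>"
    and lip: "lipschitz_on_bounded_sets \<Phi>"
    and maximizer: "\<And>\<delta>. \<delta> > 0 \<Longrightarrow>
      is_arg_max (\<lambda>x. measure \<mu>y (ball x \<delta>)) (\<lambda>x. x \<in> inner_box_set \<gamma> \<delta>) (x\<delta> \<delta>)"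
  shows "(\<forall>\<delta> :: nat \<Rightarrow> real. (\<forall>n. \<delta> n > 0) \<longrightarrow>
            (\<exists>xbar\<in>box_set \<gamma>. \<exists>r :: nat \<Rightarrow> nat. strict_mono r \<and> (\<lambda>n. x\<delta> (\<delta> (r n))) \<longlonglongrightarrow> xbar)) \<and>
         (\<forall>\<delta> :: nat \<Rightarrow> real. (\<forall>n. \<delta> n > 0) \<and> \<delta> \<longlonglongrightarrow> 0 \<longrightarrow>
            (\<forall>xbar\<in>box_set \<gamma>.
               (\<exists>r :: nat \<Rightarrow> nat. strict_mono r \<and> (\<lambda>n. x\<delta> (\<delta> (r n))) \<longlonglongrightarrow> xbar) \<longrightarrow>
               is_arg_min (functional_I \<Phi> \<gamma>) (\<lambda>_. True) xbar)) \<and>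
         (\<forall>xhat. is_arg_min (functional_I \<Phi> \<gamma>) (\<lambda>_. True) xhat \<longleftrightarrow> generalized_mode \<mu>y xhat)"
proof -
  interpret uniform_box_posterior \<gamma> P \<xi> \<Phi>
    by unfold_locales (use gamma_nonneg gamma_lim xi Z_pos Z_fin lip prior in auto)
  obtain L where L: "L > 0"
    "\<And>x w. x \<in> box_set \<gamma> \<Longrightarrow> dist x w \<le> 1 \<Longrightarrow> \<bar>\<Phi> x - \<Phi> w\<bar> \<le> L * dist x w"
    using lipschitz_near_box by blast
  have post_eq: "\<mu>y = posterior (uniform_prior P \<xi> \<gamma>) \<Phi>" using post prior by simp
  show ?thesis
  proof (intro conjI allI impI ballI)
    fix \<delta> :: "nat \<Rightarrow> real" assume d: "\<forall>n. \<delta> n > 0"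
    have *: "\<forall>n. x\<delta> (\<delta> n) \<in> box_set \<gamma>"
    proof
      fix n
      have "x\<delta> (\<delta> n) \<in> inner_box_set \<gamma> (\<delta> n)"
        using maximizer[of "\<delta> n"] d by (simp add: is_arg_max_def)
      then show "x\<delta> (\<delta> n) \<in> box_set \<gamma>"
        using inner_box_subset[of \<gamma> "\<delta> n"] gamma_nonneg d by (blast intro: less_imp_le)
    qed
    obtain xbar r where "xbar \<in> box_set \<gamma>" "strict_mono r" "((\<lambda>n. x\<delta> (\<delta> n)) \<circ> r) \<longlonglongrightarrow> xbar"
      using compact_box_set[OF gamma_lim, unfolded compact_def, rule_format, of "\<lambda>n. x\<delta> (\<delta> n)"] * by blast
    then show "\<exists>xbar\<in>box_set \<gamma>. \<exists>r :: nat \<Rightarrow> nat. strict_mono r \<and> (\<lambda>n. x\<delta> (\<delta> (r n))) \<longlonglongrightarrow> xbar"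
      unfolding o_def by blast
  next
    fix \<delta> :: "nat \<Rightarrow> real" and xbar
    assume "(\<forall>n. \<delta> n > 0) \<and> \<delta> \<longlonglongrightarrow> 0" and x: "xbar \<in> box_set \<gamma>"
      and "\<exists>r :: nat \<Rightarrow> nat. strict_mono r \<and> (\<lambda>n. x\<delta> (\<delta> (r n))) \<longlonglongrightarrow> xbar"
    then obtain r :: "nat \<Rightarrow> nat" where d: "\<And>n. \<delta> n > 0" "\<delta> \<longlonglongrightarrow> 0"
      and r: "strict_mono r" "(\<lambda>n. x\<delta> (\<delta> (r n))) \<longlonglongrightarrow> xbar" by blast
    have "(\<lambda>n. \<delta> (r n)) \<longlonglongrightarrow> 0" using LIMSEQ_subseq_LIMSEQ[OF d(2) r(1)] by (simp add: o_def)
    then have "minimizer xbar"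
      using limit_of_maximizers[OF L, of "\<lambda>n. \<delta> (r n)" "\<lambda>n. x\<delta> (\<delta> (r n))" xbar] maximizer d(1) r(2) x
      by (simp add: post_eq)
    then show "is_arg_min (functional_I \<Phi> \<gamma>) (\<lambda>_. True) xbar"
      by (simp add: is_arg_min_functional_I)
  next
    fix xhat
    show "is_arg_min (functional_I \<Phi> \<gamma>) (\<lambda>_. True) xhat \<longleftrightarrow> generalized_mode \<mu>y xhat"
      using minimizer_imp_mode[OF L] mode_imp_minimizer[OF L]
      by (auto simp: is_arg_min_functional_I post_eq)
  qed
qed

end
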